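(* Let $\mathbb E=\mathbb R$ or $\mathbb E=\mathbb C$. If $k,n\in\mathbb N$ with $k>n$, then there is a homeomorphism $\gamma_{k,n}:\mathcal G^{\mathbb E}_{k,n}\to\mathcal G^{\mathbb E}_{k,k-n}$ given by $\gamma_{k,n}\big(\frac kn P\big)=\frac{k}{k-n}(I-P)$.
   Context: $\mathbb N=\{1,2,\dots\}$. For $k>n\ge 1$, $\mathcal G^{\mathbb E}_{k,n}=\{\frac kn P\mid P\in M_k(\mathbb E)$ a projection (self-adjoint idempotent) of rank $n$, $P_{ii}=\frac nk$ for $1\le i\le k\}$, with the relative topology from $M_k(\mathbb E)$. (It is the space of spherical tight frames of $k$ vectors in $\mathbb E^n$ modulo orthogonal/unitary transformations of $\mathbb E^n$.) *)

theory Defs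
  imports "HOL-Analysis.Analysis" "Jordan_Normal_Form.Conjugate"
begin

text \<open>
  The type variable \<open>'a\<close> stands for the scalar field, to be instantiated with \<^typ>\<open>real\<close> or
  \<^typ>\<open>complex\<close>; \<^const>\<open>conjugate\<close> is the identity on the former and \<^const>\<open>cnj\<close> on the latter.
  The number \<open>k\<close> of frame vectors is \<open>CARD('k)\<close>.
\<close>

definition conjugate_transpose ::
    "('a::conjugatable_field)^'n^'m \<Rightarrow> 'a^'m^'n" where
  "conjugate_transpose A = (\<chi> i j. conjugate (A $ j $ i))"

definition is_projection :: "('a::conjugatable_field)^'k^'k \<Rightarrow> bool" where
  "is_projection P \<longleftrightarrow> conjugate_transpose P = P \<and> P ** P = P"

definition spherical_projections ::
    "nat \<Rightarrow> (('a::{conjugatable_field,real_normed_field})^'k^'k) set" where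
  "spherical_projections n =
     {P. is_projection P \<and> rank P = n \<and>
         (\<forall>i. P $ i $ i = of_real (real n / real CARD('k)))}"

text \<open>
  The space \<open>\<G>\<^bsub>k,n\<^esub>\<close> of spherical tight frames of \<open>k\<close> vectors in \<open>n\<close>-dimensional space, modulo
  orthogonal or unitary transformations; a frame is represented by its Gram matrix.
\<close>

definition spherical_tight_frames ::
    "nat \<Rightarrow> (('a::{conjugatable_field,real_normed_field})^'k^'k) set" where
  "spherical_tight_frames n =
     {(real CARD('k) / real n) *\<^sub>R P | P. P \<in> spherical_projections n}"

end

theory Submission
  imports Defs
begin

text \<open>
  In coordinates \<open>X = (k/n) P\<close> the map \<open>(k/n) P \<mapsto> (k/(k-n)) (I - P)\<close> is the affine map
  \<open>X \<mapsto> (k/(k-n)) (I - (n/k) X)\<close>, hence continuous on the whole matrix space, and the affine map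
  belonging to \<open>k - n\<close> in place of \<open>n\<close> is its inverse. It remains to see that \<open>P \<mapsto> I - P\<close> carries
  spherical projections of rank \<open>n\<close> to spherical projections of rank \<open>k - n\<close>. Self-adjointness,
  idempotence and the value of the diagonal are immediate. For the rank, an idempotent splits the
  space as the direct sum of the ranges of \<open>P\<close> and \<open>I - P\<close>; this holds over every field
  (\<open>rank_idempotent_complement\<close>), so the real and the complex case are treated together.
\<close>

lemma vec_span_columns:
  fixes A :: "'a::field^'n^'m"
  shows "vec.span (columns A) = range ((*v) A)"
proof
  have "vec.subspace (range ((*v) A))"
    using vec.subspace_UNIV by (rule vec.subspace_image)
  moreover have "columns A \<subseteq> range ((*v) A)"
  proof -
    have "column i A = A *v axis i 1" for i
      by (simp add: matrix_mult_sum axis_def if_distrib[of "\<lambda>c. c *s _"] cong: if_cong)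
    then show ?thesis
      unfolding columns_def by auto
  qed
  ultimately show "vec.span (columns A) \<subseteq> range ((*v) A)"
    by (simp add: vec.span_minimal)
  show "range ((*v) A) \<subseteq> vec.span (columns A)"
    using matrix_vector_mult_in_columnspace_gen by auto
qed

text \<open>The transpose appears because the rank is by definition the dimension of the row space.\<close>

lemma rank_eq_dim_range_transpose:
  fixes A :: "'a::field^'n^'m"
  shows "rank A = vec.dim (range ((*v) (transpose A)))"
  unfolding row_rank_def_gen using vec_span_columns[of "transpose A"]
  by (metis columns_transpose vec.dim_span)

lemma dim_range_idempotent_complement:
  fixes Q :: "'a::field^'k^'k"
  assumes "Q ** Q = Q"
  shows "vec.dim (range ((*v) Q)) + vec.dim (range ((*v) (mat 1 - Q))) = CARD('k)"
proof -
  let ?S = "range ((*v) Q)" and ?T = "range ((*v) (mat 1 - Q))"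
  have QQ: "Q *v (Q *v x) = Q *v x" for x
    using assms by (simp add: matrix_vector_mul_assoc)
  have compl: "(mat 1 - Q) *v x = x - Q *v x" for x
    by (simp add: matrix_vector_mult_diff_rdistrib)
  have "x = 0" if x: "x \<in> ?S" "x \<in> ?T" for x
  proof -
    obtain y z where "x = Q *v y" "x = z - Q *v z"
      using x unfolding compl by blast
    have "Q *v x = x"
      by (simp add: \<open>x = Q *v y\<close> QQ)
    moreover have "Q *v x = 0"
      unfolding \<open>x = z - Q *v z\<close> by (simp add: QQ matrix_vector_mult_diff_distrib)
    ultimately show ?thesis by simp
  qed
  then have "?S \<inter> ?T = {0}"
    by (auto intro: range_eqI[where x = 0])
  moreover have "{x + y |x y. x \<in> ?S \<and> y \<in> ?T} = UNIV"
  proof -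
    have "x = Q *v x + (mat 1 - Q) *v x" for x
      by (simp add: compl)
    then show ?thesis by blast
  qed
  moreover have "vec.subspace ?S" "vec.subspace ?T"
    using vec.subspace_UNIV by (rule vec.subspace_image)+
  ultimately show ?thesis
    using vec.dim_sums_Int[of ?S ?T] by (simp add: vec_dim_card del: vec.dim_UNIV)
qed

lemma rank_idempotent_complement:
  fixes P :: "'a::field^'k^'k"
  assumes "P ** P = P"
  shows "rank P + rank (mat 1 - P) = CARD('k)"
proof -
  have "transpose P ** transpose P = transpose P"
    using assms by (simp flip: matrix_transpose_mul)
  moreover have "transpose (mat 1 - P) = mat 1 - transpose P"
    by (simp add: transpose_def mat_def vec_eq_iff)
  ultimately show ?thesis
    by (simp add: rank_eq_dim_range_transpose dim_range_idempotent_complement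
        del: transpose_matrix_vector)
qed

lemma conjugate_one: "conjugate (1::'a::conjugatable_field) = 1"
proof -
  have "conjugate 1 * conjugate 1 = conjugate (1::'a) * 1"
    by (simp flip: conjugate_dist_mul)
  then show ?thesis
    by (simp del: mult_1_right)
qed

lemma is_projection_complement:
  fixes P :: "'a::conjugatable_field^'k^'k"
  assumes "is_projection P"
  shows "is_projection (mat 1 - P)"
proof -
  have "P ** P = P" and adj: "conjugate (P $ j $ i) = P $ i $ j" for i j
    using assms by (auto simp: is_projection_def conjugate_transpose_def vec_eq_iff)
  have conjugate_diff: "conjugate (a - b) = conjugate a - conjugate b" for a b :: 'a
    using conjugate_dist_add[of a "- b"] by (simp add: conjugate_neg)
  have "conjugate_transpose (mat 1 - P) = mat 1 - P"
    by (auto simp: conjugate_transpose_def mat_def vec_eq_iff conjugate_diff conjugate_one adj)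
  moreover have "(mat 1 - P) ** (mat 1 - P) = mat 1 - P"
    using \<open>P ** P = P\<close>
    by (simp add: matrix_eq matrix_vector_mult_diff_rdistrib matrix_vector_mult_diff_distrib
        flip: matrix_vector_mul_assoc)
  ultimately show ?thesis
    by (simp add: is_projection_def)
qed

lemma spherical_projections_complement:
  fixes P :: "'a::{conjugatable_field,real_normed_field}^'k^'k"
  assumes "P \<in> spherical_projections n"
  shows "mat 1 - P \<in> spherical_projections (CARD('k) - n)"
proof -
  have P: "is_projection P" "rank P = n"
    and diag: "P $ i $ i = of_real (real n / real CARD('k))" for i
    using assms by (auto simp: spherical_projections_def)
  have rank: "n + rank (mat 1 - P) = CARD('k)"
    using P rank_idempotent_complement[of P] by (simp add: is_projection_def)
  then have "real (CARD('k) - n) / real CARD('k) = 1 - real n / real CARD('k)"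
    by (simp add: of_nat_diff diff_divide_distrib)
  then have "(mat 1 - P) $ i $ i = of_real (real (CARD('k) - n) / real CARD('k))" for i
    by (simp add: mat_def diag)
  then show ?thesis
    using is_projection_complement[OF P(1)] rank by (auto simp: spherical_projections_def)
qed

text \<open>
  The complementation map as an affine map of the whole matrix space: the inner scaling by \<open>n/k\<close>
  recovers the projection from its frame.
\<close>

definition complement_frame :: "nat \<Rightarrow> 'a::real_normed_field^'k^'k \<Rightarrow> 'a^'k^'k" where
  "complement_frame n X = (real CARD('k) / real (CARD('k) - n)) *\<^sub>R
     (mat 1 - (real n / real CARD('k)) *\<^sub>R X)"

lemma complement_frame_scaled:
  fixes P :: "'a::real_normed_field^'k^'k"
  assumes "1 \<le> n"
  shows "complement_frame n ((real CARD('k) / real n) *\<^sub>R P) =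
    (real CARD('k) / real (CARD('k) - n)) *\<^sub>R (mat 1 - P)"
  using assms by (simp add: complement_frame_def)

lemma complement_frame_in_frames:
  fixes X :: "'a::{conjugatable_field,real_normed_field}^'k^'k"
  assumes "1 \<le> n" "X \<in> spherical_tight_frames n"
  shows "complement_frame n X \<in> spherical_tight_frames (CARD('k) - n)"
proof -
  obtain P where "X = (real CARD('k) / real n) *\<^sub>R P" "P \<in> spherical_projections n"
    using assms(2) by (auto simp: spherical_tight_frames_def)
  then show ?thesis
    using complement_frame_scaled[OF assms(1)] spherical_projections_complement
    by (auto simp: spherical_tight_frames_def)
qed

lemma complement_frame_involution:
  fixes X :: "'a::real_normed_field^'k^'k"
  assumes "1 \<le> n" "n < CARD('k)"
  shows "complement_frame (CARD('k) - n) (complement_frame n X) = X"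
  using assms by (simp add: complement_frame_def)

lemma continuous_on_complement_frame: "continuous_on S (complement_frame n)"
  unfolding complement_frame_def[abs_def] by (intro continuous_intros)

theorem homeomorphism_complement_frame:
  assumes "1 \<le> n" "n < CARD('k::finite)"
  shows "homeomorphism
    (spherical_tight_frames n :: ('a::{conjugatable_field,real_normed_field}^'k^'k) set)
    (spherical_tight_frames (CARD('k) - n)) (complement_frame n) (complement_frame (CARD('k) - n))"
proof (rule homeomorphismI)
  have n: "1 \<le> CARD('k) - n" "CARD('k) - n < CARD('k)" "CARD('k) - (CARD('k) - n) = n"
    using assms by auto
  show "complement_frame n ` (spherical_tight_frames n :: ('a^'k^'k) set)
      \<subseteq> spherical_tight_frames (CARD('k) - n)"
    using complement_frame_in_frames[OF assms(1)] by blast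
  show "complement_frame (CARD('k) - n) ` (spherical_tight_frames (CARD('k) - n) :: ('a^'k^'k) set)
      \<subseteq> spherical_tight_frames n"
    using complement_frame_in_frames[where 'k='k, OF n(1)] unfolding n(3) by blast
  show "complement_frame (CARD('k) - n) (complement_frame n X) = X" for X :: "'a^'k^'k"
    using complement_frame_involution[OF assms] .
  show "complement_frame n (complement_frame (CARD('k) - n) X) = X" for X :: "'a^'k^'k"
    using complement_frame_involution[OF n(1,2), of X] n(3) by simp
qed (rule continuous_on_complement_frame)+

theorem corollary2p7:
  fixes n :: nat
  assumes "1 \<le> n" and "n < CARD('k::finite)"
  shows "(\<exists>\<gamma> \<gamma>'. homeomorphism
            (spherical_tight_frames n :: (real^'k^'k) set)
            (spherical_tight_frames (CARD('k) - n) :: (real^'k^'k) set) \<gamma> \<gamma>' \<and>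
          (\<forall>P \<in> spherical_projections n.
             \<gamma> ((real CARD('k) / real n) *\<^sub>R P) =
               (real CARD('k) / real (CARD('k) - n)) *\<^sub>R (mat 1 - P))) \<and>
         (\<exists>\<gamma> \<gamma>'. homeomorphism
            (spherical_tight_frames n :: (complex^'k^'k) set)
            (spherical_tight_frames (CARD('k) - n) :: (complex^'k^'k) set) \<gamma> \<gamma>' \<and>
          (\<forall>P \<in> spherical_projections n.
             \<gamma> ((real CARD('k) / real n) *\<^sub>R P) =
               (real CARD('k) / real (CARD('k) - n)) *\<^sub>R (mat 1 - P)))"
  by (intro conjI exI[of _ "complement_frame n"] exI[of _ "complement_frame (CARD('k) - n)"] ballI
      homeomorphism_complement_frame[OF assms] complement_frame_scaled[OF assms(1)])

end
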